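(* Let $n$ be a positive integer and let $a,b$ be integers such that $\gcd(a,n)=\gcd(b,n)=1$. Then there is a ring isomorphism $$\left(\frac{a,b}{\mathbb{Z}/n\mathbb{Z}}\right)\cong\begin{cases}\mathbb{H}(\mathbb{Z}/n\mathbb{Z}), & \text{if } a\equiv b\equiv -1\pmod 4;\\ \mathbb{L}(\mathbb{Z}/n\mathbb{Z}), & \text{otherwise.}\end{cases}$$
   Context: For a commutative associative ring $R$ with identity and units $a,b\in R$, the quaternion ring $\left(\frac{a,b}{R}\right)$ is the free $R$-module of rank $4$ with basis $\{1,i,j,k\}$, equipped with the associative, unital, $R$-bilinear multiplication determined by $i^2=a$, $j^2=b$, $ij=-ji=k$. For integers $a,b$ coprime to $n$, $\left(\frac{a,b}{\mathbb{Z}/n\mathbb{Z}}\right)$ is formed with the residue classes of $a,b$ modulo $n$. Notation: $\mathbb{H}(R)=\left(\frac{-1,-1}{R}\right)$ and $\mathbb{L}(R)=\left(\frac{1,1}{R}\right)$. *)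

theory Defs
  imports "HOL-Algebra.Algebra" "HOL-Number_Theory.Cong"
begin

text \<open>
  The quadruple \<open>(x0, x1, x2, x3)\<close> stands for \<open>x0 + x1 i + x2 j + x3 k\<close>, so the carrier is the
  free module \<open>R\<^sup>4\<close>.  The product is the bilinear extension of the multiplication table that
  \<open>i\<^sup>2 = a\<close>, \<open>j\<^sup>2 = b\<close>, \<open>ij = -ji = k\<close> and associativity force, namely additionally
  \<open>k\<^sup>2 = -ab\<close>, \<open>ik = -ki = a j\<close> and \<open>kj = -jk = b i\<close>.
\<close>

definition quaternion_ring ::
    "('r, 'm) ring_scheme \<Rightarrow> 'r \<Rightarrow> 'r \<Rightarrow> ('r \<times> 'r \<times> 'r \<times> 'r) ring" where
  "quaternion_ring R a b =
    \<lparr>carrier = carrier R \<times> carrier R \<times> carrier R \<times> carrier R,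
     monoid.mult = (\<lambda>(x0, x1, x2, x3) (y0, y1, y2, y3).
       (x0 \<otimes>\<^bsub>R\<^esub> y0 \<oplus>\<^bsub>R\<^esub> a \<otimes>\<^bsub>R\<^esub> x1 \<otimes>\<^bsub>R\<^esub> y1
          \<oplus>\<^bsub>R\<^esub> b \<otimes>\<^bsub>R\<^esub> x2 \<otimes>\<^bsub>R\<^esub> y2 \<ominus>\<^bsub>R\<^esub> a \<otimes>\<^bsub>R\<^esub> b \<otimes>\<^bsub>R\<^esub> x3 \<otimes>\<^bsub>R\<^esub> y3,
        x0 \<otimes>\<^bsub>R\<^esub> y1 \<oplus>\<^bsub>R\<^esub> x1 \<otimes>\<^bsub>R\<^esub> y0
          \<ominus>\<^bsub>R\<^esub> b \<otimes>\<^bsub>R\<^esub> x2 \<otimes>\<^bsub>R\<^esub> y3 \<oplus>\<^bsub>R\<^esub> b \<otimes>\<^bsub>R\<^esub> x3 \<otimes>\<^bsub>R\<^esub> y2,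
        x0 \<otimes>\<^bsub>R\<^esub> y2 \<oplus>\<^bsub>R\<^esub> x2 \<otimes>\<^bsub>R\<^esub> y0
          \<oplus>\<^bsub>R\<^esub> a \<otimes>\<^bsub>R\<^esub> x1 \<otimes>\<^bsub>R\<^esub> y3 \<ominus>\<^bsub>R\<^esub> a \<otimes>\<^bsub>R\<^esub> x3 \<otimes>\<^bsub>R\<^esub> y1,
        x0 \<otimes>\<^bsub>R\<^esub> y3 \<oplus>\<^bsub>R\<^esub> x3 \<otimes>\<^bsub>R\<^esub> y0
          \<oplus>\<^bsub>R\<^esub> x1 \<otimes>\<^bsub>R\<^esub> y2 \<ominus>\<^bsub>R\<^esub> x2 \<otimes>\<^bsub>R\<^esub> y1)),
     monoid.one = (\<one>\<^bsub>R\<^esub>, \<zero>\<^bsub>R\<^esub>, \<zero>\<^bsub>R\<^esub>, \<zero>\<^bsub>R\<^esub>),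
     ring.zero = (\<zero>\<^bsub>R\<^esub>, \<zero>\<^bsub>R\<^esub>, \<zero>\<^bsub>R\<^esub>, \<zero>\<^bsub>R\<^esub>),
     ring.add = (\<lambda>(x0, x1, x2, x3) (y0, y1, y2, y3).
       (x0 \<oplus>\<^bsub>R\<^esub> y0, x1 \<oplus>\<^bsub>R\<^esub> y1, x2 \<oplus>\<^bsub>R\<^esub> y2, x3 \<oplus>\<^bsub>R\<^esub> y3))\<rparr>"

definition quaternion_H :: "('r, 'm) ring_scheme \<Rightarrow> ('r \<times> 'r \<times> 'r \<times> 'r) ring" where
  "quaternion_H R = quaternion_ring R (\<ominus>\<^bsub>R\<^esub> \<one>\<^bsub>R\<^esub>) (\<ominus>\<^bsub>R\<^esub> \<one>\<^bsub>R\<^esub>)"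

definition quaternion_L :: "('r, 'm) ring_scheme \<Rightarrow> ('r \<times> 'r \<times> 'r \<times> 'r) ring" where
  "quaternion_L R = quaternion_ring R \<one>\<^bsub>R\<^esub> \<one>\<^bsub>R\<^esub>"

definition residue_class :: "int \<Rightarrow> int \<Rightarrow> int set" where
  "residue_class n a = Idl\<^bsub>\<Z>\<^esub> {n} +>\<^bsub>\<Z>\<^esub> a"

lemma (in cring) quaternion_mult_assoc:
  assumes [simp]: "a \<in> carrier R" "b \<in> carrier R"
    "x0 \<in> carrier R" "x1 \<in> carrier R" "x2 \<in> carrier R" "x3 \<in> carrier R"
    "y0 \<in> carrier R" "y1 \<in> carrier R" "y2 \<in> carrier R" "y3 \<in> carrier R"
    "z0 \<in> carrier R" "z1 \<in> carrier R" "z2 \<in> carrier R" "z3 \<in> carrier R"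
  defines "Q \<equiv> quaternion_ring R a b"
  shows "(x0, x1, x2, x3) \<otimes>\<^bsub>Q\<^esub> (y0, y1, y2, y3) \<otimes>\<^bsub>Q\<^esub> (z0, z1, z2, z3)
    = (x0, x1, x2, x3) \<otimes>\<^bsub>Q\<^esub> ((y0, y1, y2, y3) \<otimes>\<^bsub>Q\<^esub> (z0, z1, z2, z3))"
  unfolding Q_def quaternion_ring_def monoid.simps ring.simps split prod.inject a_minus_def
  apply (intro conjI)
     apply (simp_all only: l_distr r_distr l_minus r_minus minus_add m_assoc a_assoc
      m_closed a_closed a_inv_closed minus_minus assms(1-14))
     apply (simp_all only: m_comm m_lcomm m_closed assms(1-14))
     apply (simp_all only: a_comm a_lcomm a_closed a_inv_closed m_closed assms(1-14))
  done

lemma (in cring) quaternion_l_distr: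
  assumes [simp]: "a \<in> carrier R" "b \<in> carrier R"
    "x0 \<in> carrier R" "x1 \<in> carrier R" "x2 \<in> carrier R" "x3 \<in> carrier R"
    "y0 \<in> carrier R" "y1 \<in> carrier R" "y2 \<in> carrier R" "y3 \<in> carrier R"
    "z0 \<in> carrier R" "z1 \<in> carrier R" "z2 \<in> carrier R" "z3 \<in> carrier R"
  defines "Q \<equiv> quaternion_ring R a b"
  shows "((x0, x1, x2, x3) \<oplus>\<^bsub>Q\<^esub> (y0, y1, y2, y3)) \<otimes>\<^bsub>Q\<^esub> (z0, z1, z2, z3)
    = (x0, x1, x2, x3) \<otimes>\<^bsub>Q\<^esub> (z0, z1, z2, z3) \<oplus>\<^bsub>Q\<^esub> (y0, y1, y2, y3) \<otimes>\<^bsub>Q\<^esub> (z0, z1, z2, z3)"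
  unfolding Q_def quaternion_ring_def monoid.simps ring.simps split prod.inject a_minus_def
  apply (intro conjI)
     apply (simp_all only: l_distr r_distr l_minus r_minus minus_add m_assoc a_assoc
      m_closed a_closed a_inv_closed minus_minus assms(1-14))
     apply (simp_all only: a_comm a_lcomm a_closed a_inv_closed m_closed assms(1-14))
  done

lemma (in cring) quaternion_r_distr:
  assumes [simp]: "a \<in> carrier R" "b \<in> carrier R"
    "x0 \<in> carrier R" "x1 \<in> carrier R" "x2 \<in> carrier R" "x3 \<in> carrier R"
    "y0 \<in> carrier R" "y1 \<in> carrier R" "y2 \<in> carrier R" "y3 \<in> carrier R"
    "z0 \<in> carrier R" "z1 \<in> carrier R" "z2 \<in> carrier R" "z3 \<in> carrier R"
  defines "Q \<equiv> quaternion_ring R a b"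
  shows "(z0, z1, z2, z3) \<otimes>\<^bsub>Q\<^esub> ((x0, x1, x2, x3) \<oplus>\<^bsub>Q\<^esub> (y0, y1, y2, y3))
    = (z0, z1, z2, z3) \<otimes>\<^bsub>Q\<^esub> (x0, x1, x2, x3) \<oplus>\<^bsub>Q\<^esub> (z0, z1, z2, z3) \<otimes>\<^bsub>Q\<^esub> (y0, y1, y2, y3)"
  unfolding Q_def quaternion_ring_def monoid.simps ring.simps split prod.inject a_minus_def
  apply (intro conjI)
     apply (simp_all only: l_distr r_distr l_minus r_minus minus_add m_assoc a_assoc
      m_closed a_closed a_inv_closed minus_minus assms(1-14))
     apply (simp_all only: a_comm a_lcomm a_closed a_inv_closed m_closed assms(1-14))
  done

lemma (in cring) quaternion_ring_ring:
  assumes a: "a \<in> carrier R" and b: "b \<in> carrier R"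
  shows "ring (quaternion_ring R a b)" (is "ring ?Q")
proof (rule ringI)
  show "abelian_group ?Q"
  proof (rule abelian_groupI)
    show "\<And>x. x \<in> carrier ?Q \<Longrightarrow> \<exists>y\<in>carrier ?Q. y \<oplus>\<^bsub>?Q\<^esub> x = \<zero>\<^bsub>?Q\<^esub>"
    proof -
      fix x assume "x \<in> carrier ?Q"
      then obtain x0 x1 x2 x3 where x: "x = (x0, x1, x2, x3)"
        "x0 \<in> carrier R" "x1 \<in> carrier R" "x2 \<in> carrier R" "x3 \<in> carrier R"
        by (auto simp: quaternion_ring_def)
      then show "\<exists>y\<in>carrier ?Q. y \<oplus>\<^bsub>?Q\<^esub> x = \<zero>\<^bsub>?Q\<^esub>"
        by (intro bexI[of _ "(\<ominus> x0, \<ominus> x1, \<ominus> x2, \<ominus> x3)"])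
          (auto simp: quaternion_ring_def l_neg)
    qed
  qed (auto simp: quaternion_ring_def a_ac)
  have carr: "carrier ?Q = carrier R \<times> carrier R \<times> carrier R \<times> carrier R"
    by (simp add: quaternion_ring_def)
  show "monoid ?Q"
  proof (rule monoidI)
    show "\<And>x y z. x \<in> carrier ?Q \<Longrightarrow> y \<in> carrier ?Q \<Longrightarrow> z \<in> carrier ?Q \<Longrightarrow>
        x \<otimes>\<^bsub>?Q\<^esub> y \<otimes>\<^bsub>?Q\<^esub> z = x \<otimes>\<^bsub>?Q\<^esub> (y \<otimes>\<^bsub>?Q\<^esub> z)"
      unfolding carr by (safe intro!: quaternion_mult_assoc a b)
  qed (use a b in \<open>auto simp: quaternion_ring_def a_minus_def\<close>)
  show "\<And>x y z. x \<in> carrier ?Q \<Longrightarrow> y \<in> carrier ?Q \<Longrightarrow> z \<in> carrier ?Q \<Longrightarrow>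
      (x \<oplus>\<^bsub>?Q\<^esub> y) \<otimes>\<^bsub>?Q\<^esub> z = x \<otimes>\<^bsub>?Q\<^esub> z \<oplus>\<^bsub>?Q\<^esub> y \<otimes>\<^bsub>?Q\<^esub> z"
    unfolding carr by (safe intro!: quaternion_l_distr a b)
  show "\<And>x y z. x \<in> carrier ?Q \<Longrightarrow> y \<in> carrier ?Q \<Longrightarrow> z \<in> carrier ?Q \<Longrightarrow>
      z \<otimes>\<^bsub>?Q\<^esub> (x \<oplus>\<^bsub>?Q\<^esub> y) = z \<otimes>\<^bsub>?Q\<^esub> x \<oplus>\<^bsub>?Q\<^esub> z \<otimes>\<^bsub>?Q\<^esub> y"
    unfolding carr by (safe intro!: quaternion_r_distr a b)
qed

lemma (in cring) quaternion_ring_relations: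
  fixes a b
  defines "Q \<equiv> quaternion_ring R a b"
  defines "i \<equiv> (\<zero>, \<one>, \<zero>, \<zero>)" and "j \<equiv> (\<zero>, \<zero>, \<one>, \<zero>)" and "k \<equiv> (\<zero>, \<zero>, \<zero>, \<one>)"
  assumes "a \<in> carrier R" "b \<in> carrier R"
  shows "i \<otimes>\<^bsub>Q\<^esub> i = (a, \<zero>, \<zero>, \<zero>)" "j \<otimes>\<^bsub>Q\<^esub> j = (b, \<zero>, \<zero>, \<zero>)"
    "i \<otimes>\<^bsub>Q\<^esub> j = k" "k \<oplus>\<^bsub>Q\<^esub> j \<otimes>\<^bsub>Q\<^esub> i = \<zero>\<^bsub>Q\<^esub>"
  using assms(5,6) by (auto simp: quaternion_ring_def a_minus_def l_neg r_neg Q_def i_def j_def k_def)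

lemma (in cring) quaternion_ring_scalar:
  fixes a b
  defines "Q \<equiv> quaternion_ring R a b"
  assumes "a \<in> carrier R" "b \<in> carrier R" "r \<in> carrier R"
    "x0 \<in> carrier R" "x1 \<in> carrier R" "x2 \<in> carrier R" "x3 \<in> carrier R"
  shows "(r, \<zero>, \<zero>, \<zero>) \<otimes>\<^bsub>Q\<^esub> (x0, x1, x2, x3) = (r \<otimes> x0, r \<otimes> x1, r \<otimes> x2, r \<otimes> x3)"
    "(x0, x1, x2, x3) \<otimes>\<^bsub>Q\<^esub> (r, \<zero>, \<zero>, \<zero>) = (r \<otimes> x0, r \<otimes> x1, r \<otimes> x2, r \<otimes> x3)"
  using assms(2-) by (auto simp: quaternion_ring_def a_minus_def Q_def m_comm)

lemma residue_class_Units: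
  assumes "coprime a n"
  shows "residue_class n a \<in> Units (ZFact n)"
proof -
  have I: "ideal (Idl\<^bsub>\<Z>\<^esub> {n}) \<Z>"
    by (simp add: int.genideal_ideal)
  obtain u where u: "[a * u = 1] (mod n)"
    using assms cong_solve_coprime_int by blast
  have coset: "residue_class n x = {y. [y = x] (mod n)}" for x
    by (auto simp: residue_class_def a_r_coset_def r_coset_def int_Idl cong_iff_dvd_diff dvd_def
        algebra_simps)
  have eq: "residue_class n x = residue_class n y" if "[x = y] (mod n)" for x y
    using that unfolding coset by (auto intro: cong_trans cong_sym)
  have mult: "residue_class n x \<otimes>\<^bsub>ZFact n\<^esub> residue_class n y = residue_class n (x * y)" for x y
    using ideal.rcoset_mult_add[OF I, of x y]
    by (simp add: ZFact_def FactRing_def residue_class_def)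
  have cl: "residue_class n x \<in> carrier (ZFact n)" for x
    by (auto simp: ZFact_defs residue_class_def A_RCOSETS_def RCOSETS_def a_r_coset_def)
  have one: "\<one>\<^bsub>ZFact n\<^esub> = residue_class n 1"
    by (simp add: ZFact_defs residue_class_def)
  show ?thesis
    unfolding Units_def using cl[of a] cl[of u] mult[of a u] mult[of u a] eq[OF u] one
    by (auto simp: mult.commute)
qed

end

theory Submission
  imports Defs
begin

text \<open>
  Two changes of generators relate quaternion rings over a commutative ring.  Exchanging \<open>i\<close> and
  \<open>j\<close> gives \<open>(a, b) \<cong> (b, a)\<close> (\<open>quaternion_ring_swap\<close>), and replacing \<open>j\<close> by \<open>(x + y i) j\<close> gives
  \<open>(a, b) \<cong> (a, b (x\<^sup>2 - a y\<^sup>2))\<close> whenever \<open>x\<^sup>2 - a y\<^sup>2\<close> is a unit (\<open>quaternion_ring_mult_norm\<close>).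
  So the theorem depends on the units modulo \<open>n\<close> that the binary form \<open>x\<^sup>2 - a y\<^sup>2\<close> represents.

  If \<open>n\<close> is odd, the form represents all units: modulo a prime by the pigeonhole principle, then
  modulo powers by lifting, and in general by the Chinese remainder theorem.  Modulo a power of \<open>2\<close>
  it represents every unit if \<open>a \<equiv> 1 (mod 4)\<close>, and at least those units \<open>c \<equiv> 1 (mod 4)\<close> for any
  odd \<open>a\<close>; both follow from inspection modulo \<open>8\<close>.  This is \<open>norm_form_represents_unit\<close>.

  Consequently \<open>(a, b) \<cong> (a, e)\<close> for units \<open>b\<close>, \<open>e\<close> if \<open>n\<close> is odd, or \<open>a \<equiv> 1 (mod 4)\<close>, or
  \<open>b \<equiv> e (mod 4)\<close> (\<open>quaternion_ring_residue_change\<close>).  If \<open>a \<equiv> b \<equiv> -1 (mod 4)\<close>, this yields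
  \<open>(a, b) \<cong> (a, -1) \<cong> (-1, a) \<cong> (-1, -1)\<close>.  Otherwise \<open>n\<close> is odd, or one of \<open>a\<close>, \<open>b\<close>
  is \<open>1\<close> modulo \<open>4\<close>, and in the same way \<open>(a, b) \<cong> (a, 1) \<cong> (1, a) \<cong> (1, 1)\<close>.
\<close>

section \<open>Changes of generators in quaternion rings\<close>

text \<open>
  Rewriting with \<open>polynomial_normalize\<close> sorts a polynomial expression into a sum of monomials.
  A monomial and its negative need not end up next to each other; the equations
  \<open>add_minus_cancel\<close> cancel them across up to two other summands, which is as far as the
  identities below require.
\<close>

lemma (in cring) add_minus_cancel:
  assumes "p \<in> carrier R"
  shows "z1 \<in> carrier R \<Longrightarrow> p \<oplus> (z1 \<oplus> \<ominus> p) = z1"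
    and "\<lbrakk>z1 \<in> carrier R; t \<in> carrier R\<rbrakk> \<Longrightarrow> p \<oplus> (z1 \<oplus> (\<ominus> p \<oplus> t)) = z1 \<oplus> t"
    and "\<lbrakk>z1 \<in> carrier R; z2 \<in> carrier R\<rbrakk> \<Longrightarrow> p \<oplus> (z1 \<oplus> (z2 \<oplus> \<ominus> p)) = z1 \<oplus> z2"
    and "\<lbrakk>z1 \<in> carrier R; z2 \<in> carrier R; t \<in> carrier R\<rbrakk> \<Longrightarrow>
      p \<oplus> (z1 \<oplus> (z2 \<oplus> (\<ominus> p \<oplus> t))) = z1 \<oplus> (z2 \<oplus> t)"
proof -
  have *: "p \<oplus> (s \<oplus> (\<ominus> p \<oplus> t)) = s \<oplus> t" if "s \<in> carrier R" "t \<in> carrier R" for s t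
    using that assms by (simp add: a_lcomm[of _ "\<ominus> p"] r_neg2)
  show "p \<oplus> (z1 \<oplus> \<ominus> p) = z1" if "z1 \<in> carrier R"
    using that assms *[of z1 \<zero>] by simp
  show "p \<oplus> (z1 \<oplus> (\<ominus> p \<oplus> t)) = z1 \<oplus> t" if "z1 \<in> carrier R" "t \<in> carrier R"
    using that by (rule *)
  show "p \<oplus> (z1 \<oplus> (z2 \<oplus> \<ominus> p)) = z1 \<oplus> z2" if "z1 \<in> carrier R" "z2 \<in> carrier R"
    using that assms *[of "z1 \<oplus> z2" \<zero>] by (simp add: a_assoc)
  show "p \<oplus> (z1 \<oplus> (z2 \<oplus> (\<ominus> p \<oplus> t))) = z1 \<oplus> (z2 \<oplus> t)"
    if "z1 \<in> carrier R" "z2 \<in> carrier R" "t \<in> carrier R"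
    using that assms *[of "z1 \<oplus> z2" t] by (simp add: a_assoc)
qed

lemmas (in cring) polynomial_normalize =
  m_closed a_closed a_inv_closed
  a_minus_def l_distr r_distr l_minus r_minus minus_add minus_minus
  m_assoc m_comm m_lcomm a_assoc a_comm a_lcomm
  l_neg r_neg r_neg1 r_neg2 add_minus_cancel l_zero r_zero zero_closed

lemma carrier_quaternion_ring:
  "carrier (quaternion_ring R a b) = carrier R \<times> carrier R \<times> carrier R \<times> carrier R"
  by (simp add: quaternion_ring_def)

text \<open>
  The element \<open>J = (x + y i) j\<close> anticommutes with \<open>i\<close> and satisfies
  \<open>J\<^sup>2 = (x + y i)(x - y i) j\<^sup>2 = b (x\<^sup>2 - a y\<^sup>2)\<close>.  The isomorphism keeps \<open>i\<close> and sends \<open>j\<close> to \<open>J\<close>;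
  on \<open>R j + R k\<close> it is multiplication by \<open>x + y i\<close>, which is invertible since its norm is.
\<close>

lemma (in cring) quaternion_ring_mult_norm:
  assumes closed [simp]: "a \<in> carrier R" "b \<in> carrier R" "x \<in> carrier R" "y \<in> carrier R"
    and unit: "x \<otimes> x \<ominus> a \<otimes> y \<otimes> y \<in> Units R"
  shows "quaternion_ring R a (b \<otimes> (x \<otimes> x \<ominus> a \<otimes> y \<otimes> y)) \<simeq> quaternion_ring R a b"
    (is "?Q \<simeq> ?S")
proof -
  obtain w where w_closed [simp]: "w \<in> carrier R" and w: "w \<otimes> (x \<otimes> x \<ominus> a \<otimes> y \<otimes> y) = \<one>"
    using unit Units_l_inv Units_inv_closed by blast
  define f :: "'a \<times> 'a \<times> 'a \<times> 'a \<Rightarrow> 'a \<times> 'a \<times> 'a \<times> 'a"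
    where "f = (\<lambda>(z0, z1, z2, z3).
      (z0, z1, z2 \<otimes> x \<oplus> a \<otimes> z3 \<otimes> y, z2 \<otimes> y \<oplus> z3 \<otimes> x))"
  define g :: "'a \<times> 'a \<times> 'a \<times> 'a \<Rightarrow> 'a \<times> 'a \<times> 'a \<times> 'a"
    where "g = (\<lambda>(z0, z1, z2, z3).
      (z0, z1, w \<otimes> (x \<otimes> z2 \<ominus> a \<otimes> y \<otimes> z3), w \<otimes> (x \<otimes> z3 \<ominus> y \<otimes> z2)))"
  have cancel: "w \<otimes> (x \<otimes> x \<ominus> a \<otimes> y \<otimes> y) \<otimes> z = z" if "z \<in> carrier R" for z
    using that w by simp
  have "f \<in> ring_iso ?Q ?S"
  proof (rule ring_iso_memI)
    show "bij_betw f (carrier ?Q) (carrier ?S)"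
    proof (rule bij_betw_byWitness[of _ g])
      have "w \<otimes> (x \<otimes> (z2 \<otimes> x \<oplus> a \<otimes> z3 \<otimes> y) \<ominus> a \<otimes> y \<otimes> (z2 \<otimes> y \<oplus> z3 \<otimes> x)) = z2"
           "w \<otimes> (x \<otimes> (z2 \<otimes> y \<oplus> z3 \<otimes> x) \<ominus> y \<otimes> (z2 \<otimes> x \<oplus> a \<otimes> z3 \<otimes> y)) = z3"
        if [simp]: "z2 \<in> carrier R" "z3 \<in> carrier R" for z2 z3
      proof -
        have "w \<otimes> (x \<otimes> (z2 \<otimes> x \<oplus> a \<otimes> z3 \<otimes> y) \<ominus> a \<otimes> y \<otimes> (z2 \<otimes> y \<oplus> z3 \<otimes> x))
          = w \<otimes> (x \<otimes> x \<ominus> a \<otimes> y \<otimes> y) \<otimes> z2"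
          by (simp only: polynomial_normalize closed w_closed that)
        then show "w \<otimes> (x \<otimes> (z2 \<otimes> x \<oplus> a \<otimes> z3 \<otimes> y) \<ominus> a \<otimes> y \<otimes> (z2 \<otimes> y \<oplus> z3 \<otimes> x)) = z2"
          by (simp only: cancel that)
        have "w \<otimes> (x \<otimes> (z2 \<otimes> y \<oplus> z3 \<otimes> x) \<ominus> y \<otimes> (z2 \<otimes> x \<oplus> a \<otimes> z3 \<otimes> y))
          = w \<otimes> (x \<otimes> x \<ominus> a \<otimes> y \<otimes> y) \<otimes> z3"
          by (simp only: polynomial_normalize closed w_closed that)
        then show "w \<otimes> (x \<otimes> (z2 \<otimes> y \<oplus> z3 \<otimes> x) \<ominus> y \<otimes> (z2 \<otimes> x \<oplus> a \<otimes> z3 \<otimes> y)) = z3"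
          by (simp only: cancel that)
      qed
      then show "\<forall>z\<in>carrier ?Q. g (f z) = z"
        by (auto simp: carrier_quaternion_ring f_def g_def)
      have "w \<otimes> (x \<otimes> z2 \<ominus> a \<otimes> y \<otimes> z3) \<otimes> x \<oplus> a \<otimes> (w \<otimes> (x \<otimes> z3 \<ominus> y \<otimes> z2)) \<otimes> y = z2"
           "w \<otimes> (x \<otimes> z2 \<ominus> a \<otimes> y \<otimes> z3) \<otimes> y \<oplus> w \<otimes> (x \<otimes> z3 \<ominus> y \<otimes> z2) \<otimes> x = z3"
        if [simp]: "z2 \<in> carrier R" "z3 \<in> carrier R" for z2 z3
      proof -
        have "w \<otimes> (x \<otimes> z2 \<ominus> a \<otimes> y \<otimes> z3) \<otimes> x \<oplus> a \<otimes> (w \<otimes> (x \<otimes> z3 \<ominus> y \<otimes> z2)) \<otimes> y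
          = w \<otimes> (x \<otimes> x \<ominus> a \<otimes> y \<otimes> y) \<otimes> z2"
          by (simp only: polynomial_normalize closed w_closed that)
        then show "w \<otimes> (x \<otimes> z2 \<ominus> a \<otimes> y \<otimes> z3) \<otimes> x \<oplus> a \<otimes> (w \<otimes> (x \<otimes> z3 \<ominus> y \<otimes> z2)) \<otimes> y = z2"
          by (simp only: cancel that)
        have "w \<otimes> (x \<otimes> z2 \<ominus> a \<otimes> y \<otimes> z3) \<otimes> y \<oplus> w \<otimes> (x \<otimes> z3 \<ominus> y \<otimes> z2) \<otimes> x
          = w \<otimes> (x \<otimes> x \<ominus> a \<otimes> y \<otimes> y) \<otimes> z3"
          by (simp only: polynomial_normalize closed w_closed that)
        then show "w \<otimes> (x \<otimes> z2 \<ominus> a \<otimes> y \<otimes> z3) \<otimes> y \<oplus> w \<otimes> (x \<otimes> z3 \<ominus> y \<otimes> z2) \<otimes> x = z3"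
          by (simp only: cancel that)
      qed
      then show "\<forall>z\<in>carrier ?S. f (g z) = z"
        by (auto simp: carrier_quaternion_ring f_def g_def)
    qed (auto simp: carrier_quaternion_ring f_def g_def)
  next
    fix u v assume "u \<in> carrier ?Q" "v \<in> carrier ?Q"
    then obtain u0 u1 u2 u3 v0 v1 v2 v3
      where uv: "u = (u0, u1, u2, u3)" "v = (v0, v1, v2, v3)"
        and uv_closed: "u0 \<in> carrier R" "u1 \<in> carrier R" "u2 \<in> carrier R" "u3 \<in> carrier R"
          "v0 \<in> carrier R" "v1 \<in> carrier R" "v2 \<in> carrier R" "v3 \<in> carrier R"
      by (auto simp: carrier_quaternion_ring)
    show "f (u \<otimes>\<^bsub>?Q\<^esub> v) = f u \<otimes>\<^bsub>?S\<^esub> f v"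
      unfolding uv f_def quaternion_ring_def monoid.simps ring.simps split prod.inject
      by (intro conjI; simp only: polynomial_normalize closed uv_closed)
    show "f (u \<oplus>\<^bsub>?Q\<^esub> v) = f u \<oplus>\<^bsub>?S\<^esub> f v"
      unfolding uv f_def quaternion_ring_def monoid.simps ring.simps split prod.inject
      by (intro conjI; simp only: polynomial_normalize closed uv_closed)
  qed (auto simp: f_def quaternion_ring_def)
  then show ?thesis
    by (auto simp: is_ring_iso_def)
qed

text \<open>Exchanging \<open>i\<close> and \<open>j\<close> changes the sign of \<open>k = ij\<close>.\<close>

lemma (in cring) quaternion_ring_swap:
  assumes closed [simp]: "a \<in> carrier R" "b \<in> carrier R"
  shows "quaternion_ring R a b \<simeq> quaternion_ring R b a" (is "?Q \<simeq> ?S")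
proof -
  define f :: "'a \<times> 'a \<times> 'a \<times> 'a \<Rightarrow> 'a \<times> 'a \<times> 'a \<times> 'a"
    where "f = (\<lambda>(z0, z1, z2, z3). (z0, z2, z1, \<ominus> z3))"
  have "f \<in> ring_iso ?Q ?S"
  proof (rule ring_iso_memI)
    show "bij_betw f (carrier ?Q) (carrier ?S)"
      by (rule bij_betw_byWitness[of _ f]) (auto simp: carrier_quaternion_ring f_def)
  next
    fix u v assume "u \<in> carrier ?Q" "v \<in> carrier ?Q"
    then obtain u0 u1 u2 u3 v0 v1 v2 v3
      where uv: "u = (u0, u1, u2, u3)" "v = (v0, v1, v2, v3)"
        and uv_closed: "u0 \<in> carrier R" "u1 \<in> carrier R" "u2 \<in> carrier R" "u3 \<in> carrier R"
          "v0 \<in> carrier R" "v1 \<in> carrier R" "v2 \<in> carrier R" "v3 \<in> carrier R"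
      by (auto simp: carrier_quaternion_ring)
    show "f (u \<otimes>\<^bsub>?Q\<^esub> v) = f u \<otimes>\<^bsub>?S\<^esub> f v"
      unfolding uv f_def quaternion_ring_def monoid.simps ring.simps split prod.inject
      by (intro conjI; simp only: polynomial_normalize closed uv_closed)
    show "f (u \<oplus>\<^bsub>?Q\<^esub> v) = f u \<oplus>\<^bsub>?S\<^esub> f v"
      unfolding uv f_def quaternion_ring_def monoid.simps ring.simps split prod.inject
      by (intro conjI; simp only: polynomial_normalize closed uv_closed)
  qed (auto simp: f_def quaternion_ring_def)
  then show ?thesis
    by (auto simp: is_ring_iso_def)
qed

section \<open>Units represented by the norm form modulo n\<close>

text \<open>
  Lifting from \<open>n\<close> to \<open>p n\<close> for an odd prime divisor \<open>p\<close> of \<open>n\<close>: modulo \<open>p n\<close>, the value of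
  \<open>\<alpha> x\<^sup>2\<close> depends linearly on a change of \<open>x\<close> by a multiple of \<open>n\<close>.
\<close>

lemma hensel_step_odd:
  fixes p n \<alpha> u x :: int
  assumes p: "Factorial_Ring.prime p" "odd p" and n: "p dvd n" and "\<not> p dvd \<alpha>" "\<not> p dvd x"
    and x: "[\<alpha> * x\<^sup>2 = u] (mod n)"
  shows "\<exists>x'. [\<alpha> * x'\<^sup>2 = u] (mod p * n)"
proof -
  obtain q where q: "\<alpha> * x\<^sup>2 - u = n * q"
    using x by (auto simp: cong_iff_dvd_diff dvd_def)
  have "\<not> p dvd 2"
    using p by (metis primes_dvd_imp_eq even_numeral two_is_prime_nat prime_int_numeral_eq)
  then have "\<not> p dvd 2 * \<alpha> * x"
    using assms by (simp add: prime_dvd_mult_iff)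
  then have "coprime (2 * \<alpha> * x) p"
    using p by (metis coprime_commute prime_imp_coprime)
  then obtain v where "[2 * \<alpha> * x * v = 1] (mod p)"
    using cong_solve_coprime_int by blast
  then have "[(2 * \<alpha> * x * v) * q = 1 * q] (mod p)"
    by (rule cong_scalar_right)
  then have "p dvd 2 * \<alpha> * x * v * q - q"
    by (simp add: cong_iff_dvd_diff)
  then have 1: "p * n dvd n * (2 * \<alpha> * x * v * q - q)"
    by (simp add: mult.commute)
  have 2: "p * n dvd n * n * (\<alpha> * v\<^sup>2 * q\<^sup>2)"
    using n by (meson dvd_mult2 mult_dvd_mono dvd_refl)
  have "\<alpha> * (x - n * v * q)\<^sup>2 - u = (\<alpha> * x\<^sup>2 - u) - n * (2 * \<alpha> * x * v * q) + n * n * (\<alpha> * v\<^sup>2 * q\<^sup>2)"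
    by (simp add: power2_eq_square algebra_simps)
  also have "\<dots> = n * n * (\<alpha> * v\<^sup>2 * q\<^sup>2) - n * (2 * \<alpha> * x * v * q - q)"
    unfolding q by (simp add: algebra_simps)
  finally have "p * n dvd \<alpha> * (x - n * v * q)\<^sup>2 - u"
    using 1 2 by (metis dvd_diff)
  then show ?thesis
    by (auto simp: cong_iff_dvd_diff)
qed

text \<open>
  At the prime \<open>2\<close> lifting starts modulo \<open>8\<close>: for odd \<open>x\<close>, adding \<open>2 ^ (k + 2)\<close> to \<open>x\<close> adds an
  odd multiple of \<open>2 ^ (k + 3)\<close> to \<open>x\<^sup>2\<close>.
\<close>

lemma hensel_two_power:
  fixes \<alpha> u x :: int
  assumes "odd \<alpha>" "odd x" and x: "[\<alpha> * x\<^sup>2 = u] (mod 8)"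
  shows "\<exists>x'. odd x' \<and> [\<alpha> * x'\<^sup>2 = u] (mod 2 ^ (k + 3))"
proof (induction k)
  case 0
  then show ?case using assms by auto
next
  case (Suc k)
  then obtain y where y: "odd y" "[\<alpha> * y\<^sup>2 = u] (mod 2 ^ (k + 3))" by blast
  then obtain q where q: "\<alpha> * y\<^sup>2 - u = 2 ^ (k + 3) * q"
    by (auto simp: cong_iff_dvd_diff dvd_def)
  have ev: "even (q + \<alpha> * y * q + \<alpha> * 2 ^ (k + 1) * q\<^sup>2)"
    using y assms by auto
  have "\<alpha> * (y + 2 ^ (k + 2) * q)\<^sup>2 - u =
      (\<alpha> * y\<^sup>2 - u) + 2 ^ (k + 3) * (\<alpha> * y * q + \<alpha> * 2 ^ (k + 1) * q\<^sup>2)"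
    by (simp add: power2_eq_square algebra_simps power_add)
  also have "\<dots> = 2 ^ (k + 3) * (q + \<alpha> * y * q + \<alpha> * 2 ^ (k + 1) * q\<^sup>2)"
    unfolding q by (simp add: algebra_simps)
  finally have "2 ^ (k + 3) * 2 dvd \<alpha> * (y + 2 ^ (k + 2) * q)\<^sup>2 - u"
    using ev by (metis mult_dvd_mono dvd_refl)
  then have "[\<alpha> * (y + 2 ^ (k + 2) * q)\<^sup>2 = u] (mod 2 ^ (Suc k + 3))"
    by (simp only: cong_iff_dvd_diff add_Suc power_Suc2)
  moreover have "odd (y + 2 ^ (k + 2) * q)" using y by simp
  ultimately show ?case by blast
qed

text \<open>
  A solution modulo \<open>8\<close> in which one of the variables is odd suffices, since that variable can be
  lifted while the other is kept.  Such solutions exist because \<open>1\<close> and \<open>1 - 4a \<equiv> 5\<close> are values of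
  the form modulo \<open>8\<close> for every odd \<open>a\<close>, and \<open>-a\<close> and \<open>4 - a\<close> are the other two odd classes when
  \<open>a \<equiv> 1 (mod 4)\<close>.
\<close>

lemma norm_form_mod_two_power:
  fixes a c :: int
  assumes "odd a" "odd c" and ac: "[a = 1] (mod 4) \<or> [c = 1] (mod 4)"
  shows "\<exists>x y. [x\<^sup>2 - a * y\<^sup>2 = c] (mod 2 ^ k)"
proof -
  have "\<exists>x y. [x\<^sup>2 - a * y\<^sup>2 = c] (mod 2 ^ (k + 3))"
  proof -
    consider (odd_x) y where "[1 * 1\<^sup>2 = c + a * y\<^sup>2] (mod 8)"
      | (odd_y) x where "[- a * 1\<^sup>2 = c - x\<^sup>2] (mod 8)"
    proof -
      have residues: "odd c \<Longrightarrow> c mod 8 = 1 \<or> c mod 8 = 5 \<or> c mod 4 = 3"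
        "c mod 4 = 3 \<Longrightarrow> a mod 4 = 1 \<Longrightarrow> (c + a) mod 8 = 0 \<or> (c + a) mod 8 = 4" for a c :: int
        by presburger+
      have "c mod 8 = 1 \<or> c mod 8 = 5 \<or> (c + a) mod 8 = 0 \<or> (c + a) mod 8 = 4"
        using ac residues(1)[OF \<open>odd c\<close>] residues(2)[of c a] by (auto simp: cong_def)
      then consider "c mod 8 = 1" | "c mod 8 = 5" | "(c + a) mod 8 = 0" | "(c + a) mod 8 = 4"
        by blast
      then show ?thesis
      proof cases
        case 1
        then have "[1 * 1\<^sup>2 = c + a * 0\<^sup>2] (mod 8)" by (simp add: cong_def)
        then show ?thesis by (rule that(1))
      next
        case 2
        then have "(c + a * 4) mod 8 = 1" using \<open>odd a\<close> by presburger
        then have "[1 * 1\<^sup>2 = c + a * 2\<^sup>2] (mod 8)" by (simp add: cong_def)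
        then show ?thesis by (rule that(1))
      next
        case 3
        then have "8 dvd c + a" by presburger
        then have "[c - 0\<^sup>2 = - a * 1\<^sup>2] (mod 8)" by (simp add: cong_iff_dvd_diff)
        then show ?thesis by (intro that(2)[OF cong_sym])
      next
        case 4
        then have "8 dvd c - 4 + a" by presburger
        then have "[c - 2\<^sup>2 = - a * 1\<^sup>2] (mod 8)" by (simp add: cong_iff_dvd_diff)
        then show ?thesis by (intro that(2)[OF cong_sym])
      qed
    qed
    then show ?thesis
    proof cases
      case odd_x
      then obtain x where "[1 * x\<^sup>2 = c + a * y\<^sup>2] (mod 2 ^ (k + 3))"
        using hensel_two_power[of 1 1 "c + a * y\<^sup>2" k] by auto
      then have "[x\<^sup>2 - a * y\<^sup>2 = c] (mod 2 ^ (k + 3))"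
        by (simp add: cong_iff_dvd_diff algebra_simps)
      then show ?thesis by blast
    next
      case odd_y
      then obtain y where "[- a * y\<^sup>2 = c - x\<^sup>2] (mod 2 ^ (k + 3))"
        using hensel_two_power[of "- a" 1 "c - x\<^sup>2" k] \<open>odd a\<close> by auto
      then have "[x\<^sup>2 - a * y\<^sup>2 = c] (mod 2 ^ (k + 3))"
        by (simp add: cong_iff_dvd_diff algebra_simps)
      then show ?thesis by blast
    qed
  qed
  then show ?thesis
    by (meson cong_dvd_modulus le_imp_power_dvd le_add1)
qed

text \<open>
  Pigeonhole: the squares, and the values \<open>c + a y\<^sup>2\<close>, form two sets of \<open>(p + 1) / 2\<close> residue
  classes each, so they meet.
\<close>

lemma norm_form_mod_prime:
  fixes p a c :: int
  assumes p: "Factorial_Ring.prime p" "odd p" and a: "\<not> p dvd a"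
  shows "\<exists>x y. [x\<^sup>2 - a * y\<^sup>2 = c] (mod p)"
proof -
  define S where "S = {0..(p - 1) div 2}"
  have p2: "p > 2" using p by (metis prime_ge_2_int dual_order.order_iff_strict even_numeral)
  have inj: "inj_on (\<lambda>x. (u + \<alpha> * x\<^sup>2) mod p) S" if \<alpha>: "\<not> p dvd \<alpha>" for u \<alpha>
  proof (rule inj_onI)
    fix x y assume xy: "x \<in> S" "y \<in> S" "(u + \<alpha> * x\<^sup>2) mod p = (u + \<alpha> * y\<^sup>2) mod p"
    then have "p dvd (u + \<alpha> * x\<^sup>2) - (u + \<alpha> * y\<^sup>2)"
      by (simp add: mod_eq_dvd_iff)
    also have "\<dots> = \<alpha> * ((x + y) * (x - y))"
      by (simp add: power2_eq_square algebra_simps)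
    finally have "p dvd x + y \<or> p dvd x - y"
      using p \<alpha> by (simp add: prime_dvd_mult_iff)
    moreover have "0 \<le> x + y" "x + y < p" "\<bar>x - y\<bar> < p"
      using xy p2 by (auto simp: S_def)
    ultimately have "x + y = 0 \<or> x - y = 0"
      using zdvd_not_zless[of "x + y" p] zdvd_not_zless[of "\<bar>x - y\<bar>" p]
      by (metis abs_of_nonneg dvd_abs_iff order_le_less zero_less_abs_iff)
    then show "x = y" using xy by (auto simp: S_def)
  qed
  \<comment> \<open>The set of squares is written so that \<open>inj\<close> applies to it as well.\<close>
  define A where "A = (\<lambda>x. (0 + 1 * x\<^sup>2) mod p) ` S"
  define B where "B = (\<lambda>x. (c + a * x\<^sup>2) mod p) ` S"
  have cS: "card S = nat ((p + 1) div 2)"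
  proof -
    have "(p - 1) div 2 + 1 = (p + 1) div 2"
      using p(2) by presburger
    then show ?thesis by (simp add: S_def)
  qed
  have cA: "card A = card S" and cB: "card B = card S"
    unfolding A_def B_def by (intro card_image inj a; use p2 in \<open>simp add: zdvd_not_zless\<close>)+
  have sub: "A \<union> B \<subseteq> {0..<p}"
    using p2 by (auto simp: A_def B_def)
  have "card (A \<union> B) \<le> nat p"
    using card_mono[OF _ sub] by simp
  also have "\<dots> < card A + card B"
  proof -
    have "(p + 1) div 2 + (p + 1) div 2 = p + 1"
      using p(2) by presburger
    then show ?thesis
      using p2 unfolding cA cB cS by linarith
  qed
  finally have "card (A \<union> B) < card A + card B" .
  moreover have "finite A" "finite B" using finite_subset[OF sub] by auto
  ultimately have "A \<inter> B \<noteq> {}"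
    using card_Un_disjoint by fastforce
  then obtain x y where "(0 + 1 * x\<^sup>2) mod p = (c + a * y\<^sup>2) mod p"
    unfolding A_def B_def by blast
  then have "[x\<^sup>2 - a * y\<^sup>2 = c] (mod p)"
    by (simp add: cong_iff_dvd_diff mod_eq_dvd_iff algebra_simps)
  then show ?thesis by blast
qed

lemma norm_form_mod_coprime_mult:
  fixes m n a c :: int
  assumes mn: "coprime m n"
    and "\<exists>x y. [x\<^sup>2 - a * y\<^sup>2 = c] (mod m)" "\<exists>x y. [x\<^sup>2 - a * y\<^sup>2 = c] (mod n)"
  shows "\<exists>x y. [x\<^sup>2 - a * y\<^sup>2 = c] (mod m * n)"
proof -
  obtain x1 y1 x2 y2 where 1: "[x1\<^sup>2 - a * y1\<^sup>2 = c] (mod m)" and 2: "[x2\<^sup>2 - a * y2\<^sup>2 = c] (mod n)"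
    using assms by blast
  obtain x where x: "[x = x1] (mod m)" "[x = x2] (mod n)"
    using binary_chinese_remainder_int[OF mn] by blast
  obtain y where y: "[y = y1] (mod m)" "[y = y2] (mod n)"
    using binary_chinese_remainder_int[OF mn] by blast
  have "[x\<^sup>2 - a * y\<^sup>2 = x1\<^sup>2 - a * y1\<^sup>2] (mod m)" "[x\<^sup>2 - a * y\<^sup>2 = x2\<^sup>2 - a * y2\<^sup>2] (mod n)"
    by (intro cong_diff cong_pow cong_mult cong_refl x y)+
  then have "[x\<^sup>2 - a * y\<^sup>2 = c] (mod m)" "[x\<^sup>2 - a * y\<^sup>2 = c] (mod n)"
    using 1 2 cong_trans by blast+
  then show ?thesis
    using coprime_cong_mult mn by blast
qed

text \<open>Induction on the number of prime factors, repeated ones included.\<close>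

lemma norm_form_mod_odd:
  fixes n a c :: int
  assumes "odd n" "coprime a n" "coprime c n"
  shows "\<exists>x y. [x\<^sup>2 - a * y\<^sup>2 = c] (mod n)"
  using assms
proof (induction n rule: prime_divisors_induct)
  case (unit n)
  then have "[0\<^sup>2 - a * 0\<^sup>2 = c] (mod n)"
    by (auto simp: cong_iff_dvd_diff intro: unit_imp_dvd)
  then show ?case by blast
next
  case (factor p n)
  then have p: "Factorial_Ring.prime p" "odd p" and "odd n" "coprime a n" "coprime c n" by auto
  have "coprime a p" "coprime c p" using factor.prems by auto
  then have pa: "\<not> p dvd a" and pc: "\<not> p dvd c"
    using p by (metis coprime_common_divisor dvd_refl not_prime_unit)+
  obtain x y where xy: "[x\<^sup>2 - a * y\<^sup>2 = c] (mod n)"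
    using factor by auto
  show ?case
  proof (cases "p dvd n")
    case False
    then have "coprime p n" using p by (simp add: prime_imp_coprime)
    then show ?thesis
      using norm_form_mod_coprime_mult norm_form_mod_prime[OF p pa] xy by blast
  next
    case True
    \<comment> \<open>Since \<open>c\<close> is a unit, one of \<open>x\<close>, \<open>y\<close> is prime to \<open>p\<close>; that one is corrected, the other kept.\<close>
    have "\<not> (p dvd x \<and> p dvd y)"
    proof
      assume "p dvd x \<and> p dvd y"
      then have "p dvd x\<^sup>2 - a * y\<^sup>2" by (auto simp: power2_eq_square)
      moreover have "p dvd x\<^sup>2 - a * y\<^sup>2 - c"
        using xy True by (meson cong_iff_dvd_diff dvd_trans)
      ultimately show False using pc by (metis dvd_diffD dvd_diff_right_iff)
    qed
    then consider "\<not> p dvd x" | "\<not> p dvd y" by blast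
    then show ?thesis
    proof cases
      case 1
      have "[1 * x\<^sup>2 = c + a * y\<^sup>2] (mod n)"
        using xy by (simp add: cong_iff_dvd_diff algebra_simps)
      then obtain x' where "[1 * x'\<^sup>2 = c + a * y\<^sup>2] (mod p * n)"
        using hensel_step_odd[OF p True _ 1, of 1] p by (metis not_prime_unit)
      then have "[x'\<^sup>2 - a * y\<^sup>2 = c] (mod p * n)"
        by (simp add: cong_iff_dvd_diff algebra_simps)
      then show ?thesis by blast
    next
      case 2
      have "[- a * y\<^sup>2 = c - x\<^sup>2] (mod n)"
        using xy by (simp add: cong_iff_dvd_diff algebra_simps)
      then obtain y' where "[- a * y'\<^sup>2 = c - x\<^sup>2] (mod p * n)"
        using hensel_step_odd[OF p True _ 2, of "- a"] pa by (metis dvd_minus_iff)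
      then have "[x\<^sup>2 - a * y'\<^sup>2 = c] (mod p * n)"
        by (simp add: cong_iff_dvd_diff algebra_simps)
      then show ?thesis by blast
    qed
  qed
qed auto

lemma norm_form_represents_unit:
  fixes n a c :: int
  assumes n: "n \<noteq> 0" and ac: "coprime a n" "coprime c n"
    and even: "even n \<Longrightarrow> [a = 1] (mod 4) \<or> [c = 1] (mod 4)"
  shows "\<exists>x y. [x\<^sup>2 - a * y\<^sup>2 = c] (mod n)"
proof (cases "even n")
  case False
  then show ?thesis using norm_form_mod_odd ac by blast
next
  case True
  obtain k m where nkm: "n = 2 ^ k * m" "odd m"
    using multiplicity_decompose'[OF n, of 2] by (metis odd_one)
  have "odd a" "odd c"
    using ac True by (meson coprime_common_divisor odd_one)+
  then have "\<exists>x y. [x\<^sup>2 - a * y\<^sup>2 = c] (mod 2 ^ k)"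
    using even[OF True] norm_form_mod_two_power by blast
  moreover have "\<exists>x y. [x\<^sup>2 - a * y\<^sup>2 = c] (mod m)"
    using norm_form_mod_odd nkm ac by auto
  moreover have "coprime (2 ^ k) m" using nkm by simp
  ultimately show ?thesis
    using norm_form_mod_coprime_mult nkm by blast
qed

section \<open>Quaternion rings over the integers modulo n\<close>

lemma residue_class_ring_hom: "ring_hom_cring \<Z> (ZFact n) (residue_class n)"
proof -
  have "residue_class n = (+>\<^bsub>\<Z>\<^esub>) (Idl\<^bsub>\<Z>\<^esub> {n})"
    by (rule ext) (simp add: residue_class_def)
  moreover have "ideal (Idl\<^bsub>\<Z>\<^esub> {n}) \<Z>"
    by (simp add: int.genideal_ideal)
  ultimately show ?thesis
    using ideal.rcos_ring_hom_cring int_is_cring by (metis ZFact_def)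
qed

lemma residue_class_eqI:
  assumes "[x = y] (mod n)"
  shows "residue_class n x = residue_class n y"
proof -
  have "residue_class n z = {w. [w = z] (mod n)}" for z
    by (auto simp: residue_class_def a_r_coset_def r_coset_def int_Idl cong_iff_dvd_diff dvd_def
        algebra_simps)
  then show ?thesis
    using assms by (auto intro: cong_trans cong_sym)
qed

lemma quaternion_ring_residue_mult_norm:
  assumes "[b * (x\<^sup>2 - a * y\<^sup>2) = e] (mod n)" "coprime e n"
  shows "quaternion_ring (ZFact n) (residue_class n a) (residue_class n b) \<simeq>
    quaternion_ring (ZFact n) (residue_class n a) (residue_class n e)"
proof -
  interpret hom: ring_hom_cring \<Z> "ZFact n" "residue_class n"
    by (rule residue_class_ring_hom)
  have carr [simp]: "residue_class n z \<in> carrier (ZFact n)" for z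
    using hom.hom_closed by simp
  define N where "N = x\<^sup>2 - a * y\<^sup>2"
  have N: "residue_class n N = residue_class n x \<otimes>\<^bsub>ZFact n\<^esub> residue_class n x \<ominus>\<^bsub>ZFact n\<^esub>
      residue_class n a \<otimes>\<^bsub>ZFact n\<^esub> residue_class n y \<otimes>\<^bsub>ZFact n\<^esub> residue_class n y"
  proof -
    have "N = x * x + - (a * y * y)"
      by (simp add: N_def power2_eq_square)
    then show ?thesis
      using hom.hom_add[of "x * x" "- (a * y * y)"] hom.hom_a_inv[of "a * y * y"]
        hom.hom_mult[of x x] hom.hom_mult[of "a * y" y] hom.hom_mult[of a y]
      by (simp add: a_minus_def int_a_inv_eq)
  qed
  have "coprime (b * N) n"
    using assms unfolding N_def by (metis cong_imp_coprime cong_sym)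
  then have unit: "residue_class n N \<in> Units (ZFact n)"
    by (simp add: residue_class_Units)
  have "residue_class n b \<otimes>\<^bsub>ZFact n\<^esub> residue_class n N = residue_class n e"
    using hom.hom_mult[of b N] residue_class_eqI[OF assms(1)] by (simp add: N_def)
  then have "quaternion_ring (ZFact n) (residue_class n a) (residue_class n e) \<simeq>
      quaternion_ring (ZFact n) (residue_class n a) (residue_class n b)"
    using hom.S.quaternion_ring_mult_norm[OF carr carr carr carr unit[unfolded N], of b]
    by (simp add: N)
  then show ?thesis
    by (rule ring_iso_sym[OF hom.S.quaternion_ring_ring[OF carr carr]])
qed

text \<open>The condition modulo \<open>4\<close> ensures that the form \<open>x\<^sup>2 - a y\<^sup>2\<close> represents \<open>e / b\<close>.\<close>

lemma quaternion_ring_residue_change: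
  fixes n a b e :: int
  assumes n: "n \<noteq> 0" and coprime: "coprime a n" "coprime b n" "coprime e n"
    and even: "even n \<Longrightarrow> [a = 1] (mod 4) \<or> [b = e] (mod 4)"
  shows "quaternion_ring (ZFact n) (residue_class n a) (residue_class n b) \<simeq>
    quaternion_ring (ZFact n) (residue_class n a) (residue_class n e)"
proof -
  \<comment> \<open>For even \<open>n\<close> the quotient \<open>c\<close> of \<open>e\<close> by \<open>b\<close> is taken modulo \<open>4n\<close>: modulo \<open>n\<close> alone its class
    modulo \<open>4\<close> need not be determined.\<close>
  define m where "m = (if even n then 4 * n else n)"
  have odd: "odd b" if "even n"
    using that coprime(2) by (meson coprime_common_divisor odd_one)
  have "coprime b (4 :: int)" if "odd b"
    using that coprime_power_right_iff[of b 2 2] by (simp add: coprime_right_2_iff_odd)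
  then have "coprime b m"
    using coprime(2) odd by (auto simp: m_def)
  then obtain u where u: "[b * u = 1] (mod m)"
    using cong_solve_coprime_int by blast
  define c where "c = u * e"
  have bc: "[b * c = e] (mod m)"
    using cong_scalar_right[OF u, of e] by (simp add: c_def mult.assoc)
  have bc_n: "[b * c = e] (mod n)"
    by (rule cong_dvd_modulus[OF bc]) (simp add: m_def)
  then have "coprime (b * c) n"
    using coprime(3) by (metis cong_imp_coprime cong_sym)
  then have c: "coprime c n"
    by simp
  have "[c = 1] (mod 4)" if "even n" "[b = e] (mod 4)"
  proof -
    have "[b * c = e] (mod 4)"
      by (rule cong_dvd_modulus[OF bc]) (simp add: m_def that)
    then have "[b * c = b * 1] (mod 4)"
      using cong_trans[OF _ cong_sym[OF that(2)]] by simp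
    then show ?thesis
      using cong_mult_lcancel[of b 4 c 1] \<open>odd b \<Longrightarrow> coprime b 4\<close> odd[OF that(1)] by blast
  qed
  then obtain x y where "[x\<^sup>2 - a * y\<^sup>2 = c] (mod n)"
    using norm_form_represents_unit[OF n coprime(1) c] even by blast
  then have "[b * (x\<^sup>2 - a * y\<^sup>2) = b * c] (mod n)"
    by (rule cong_scalar_left)
  then have "[b * (x\<^sup>2 - a * y\<^sup>2) = e] (mod n)"
    using bc_n by (rule cong_trans)
  then show ?thesis
    using quaternion_ring_residue_mult_norm coprime(3) by blast
qed

lemma quaternion_ring_residue_swap:
  "quaternion_ring (ZFact n) (residue_class n a) (residue_class n b) \<simeq>
    quaternion_ring (ZFact n) (residue_class n b) (residue_class n a)"
proof -
  interpret hom: ring_hom_cring \<Z> "ZFact n" "residue_class n"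
    by (rule residue_class_ring_hom)
  show ?thesis
    using hom.hom_closed by (intro hom.S.quaternion_ring_swap) simp_all
qed

text \<open>The chain \<open>(a, b) \<cong> (a, e) \<cong> (e, a) \<cong> (e, e)\<close>.\<close>

lemma quaternion_ring_residue_reduce:
  fixes n a b e :: int
  assumes n: "n \<noteq> 0" and coprime: "coprime a n" "coprime b n" "coprime e n"
    and 1: "even n \<Longrightarrow> [a = 1] (mod 4) \<or> [b = e] (mod 4)"
    and 2: "even n \<Longrightarrow> [e = 1] (mod 4) \<or> [a = e] (mod 4)"
  shows "quaternion_ring (ZFact n) (residue_class n a) (residue_class n b) \<simeq>
    quaternion_ring (ZFact n) (residue_class n e) (residue_class n e)"
  using ring_iso_trans[OF quaternion_ring_residue_change[OF n coprime 1]
      ring_iso_trans[OF quaternion_ring_residue_swap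
        quaternion_ring_residue_change[OF n coprime(3) coprime(1) coprime(3) 2]]] .

lemma quaternion_H_ZFact:
  "quaternion_H (ZFact n) = quaternion_ring (ZFact n) (residue_class n (-1)) (residue_class n (-1))"
proof -
  interpret hom: ring_hom_cring \<Z> "ZFact n" "residue_class n"
    by (rule residue_class_ring_hom)
  have "\<ominus>\<^bsub>ZFact n\<^esub> \<one>\<^bsub>ZFact n\<^esub> = residue_class n (-1)"
    using hom.hom_a_inv[of 1] hom.hom_one by (simp add: int_a_inv_eq)
  then show ?thesis
    by (simp add: quaternion_H_def)
qed

lemma quaternion_L_ZFact:
  "quaternion_L (ZFact n) = quaternion_ring (ZFact n) (residue_class n 1) (residue_class n 1)"
proof -
  interpret hom: ring_hom_cring \<Z> "ZFact n" "residue_class n"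
    by (rule residue_class_ring_hom)
  show ?thesis
    using hom.hom_one by (simp add: quaternion_L_def)
qed

theorem theorem5:
  fixes n :: nat and a b :: int
  assumes "n > 0"
    and "gcd a (int n) = 1"
    and "gcd b (int n) = 1"
  shows "quaternion_ring (ZFact (int n)) (residue_class (int n) a) (residue_class (int n) b) \<simeq>
    (if [a = b] (mod 4) \<and> [b = -1] (mod 4)
     then quaternion_H (ZFact (int n))
     else quaternion_L (ZFact (int n)))"
proof -
  have n: "int n \<noteq> 0" and a: "coprime a (int n)" and b: "coprime b (int n)"
    using assms by (simp_all add: coprime_iff_gcd_eq_1)
  show ?thesis
  proof (cases "[a = b] (mod 4) \<and> [b = -1] (mod 4)")
    case True
    then have "[a = -1] (mod 4)"
      using cong_trans by blast
    then show ?thesis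
      using True quaternion_ring_residue_reduce[OF n a b, of "-1"] by (simp add: quaternion_H_ZFact)
  next
    case False
    have "odd a" "odd b" if "even n"
      using that a b by (meson coprime_common_divisor even_of_nat odd_one)+
    moreover have "[z = 1] (mod 4) \<or> [z = -1] (mod 4)" if "odd z" for z :: int
      using that unfolding cong_def by simp presburger
    ultimately have one: "[a = 1] (mod 4) \<or> [b = 1] (mod 4)" if "even n"
      using False that by (meson cong_sym cong_trans)
    have "quaternion_ring (ZFact (int n)) (residue_class (int n) a) (residue_class (int n) b) \<simeq>
        quaternion_L (ZFact (int n))"
      using quaternion_ring_residue_reduce[OF n a b, of 1] one by (simp add: quaternion_L_ZFact)
    then show ?thesis
      by (simp only: False if_False)
  qed
qed

end
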